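(* Let $\mathcal{H}$ be an infinite-dimensional separable complex Hilbert space, let $V \in \mathcal{B}(\mathcal{H})$ be an isometry, and let $f, g \in \mathcal{H}$. Define \[ c(V; f,g) = (\|f\|^2 - \|V^*f\|^2)\, \|g\|^2 + |1 + \langle V^*f , g\rangle|^2 . \] Then $V + f \otimes g$ is left-invertible if and only if $c(V; f,g) \neq 0$.
   Context: $\mathcal{B}(\mathcal{H})$ is the algebra of bounded linear operators on $\mathcal{H}$. Inner products are linear in the first variable. For $f,g\in\mathcal{H}$, the operator $f \otimes g \in \mathcal{B}(\mathcal{H})$ is defined by $(f \otimes g)h = \langle h, g\rangle f$ for $h \in \mathcal{H}$. An isometry is an operator $V$ with $V^*V = I_{\mathcal{H}}$. An operator $T \in \mathcal{B}(\mathcal{H})$ is left-invertible if there exists $S \in \mathcal{B}(\mathcal{H})$ with $ST = I_{\mathcal{H}}$ (equivalently, $T$ is bounded below). *)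

theory Defs
  imports "HOL-Analysis.Analysis"
begin

class complex_vector = real_vector +
  fixes scaleC :: "complex \<Rightarrow> 'a \<Rightarrow> 'a" (infixr "*\<^sub>C" 75)
  assumes scaleC_add_right: "a *\<^sub>C (x + y) = a *\<^sub>C x + a *\<^sub>C y"
    and scaleC_add_left: "(a + b) *\<^sub>C x = a *\<^sub>C x + b *\<^sub>C x"
    and scaleC_scaleC: "a *\<^sub>C b *\<^sub>C x = (a * b) *\<^sub>C x"
    and scaleC_one: "1 *\<^sub>C x = x"
    and scaleR_scaleC: "r *\<^sub>R x = complex_of_real r *\<^sub>C x"

global_interpretation complex_vector: vector_space "scaleC :: complex \<Rightarrow> 'a \<Rightarrow> 'a::complex_vector"
  by unfold_locales (simp_all add: scaleC_add_right scaleC_add_left scaleC_scaleC scaleC_one)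

text \<open>The inner product is linear in the first variable. That \<open>cinner x x\<close> is real follows
  from Hermitian symmetry, so \<open>Re\<close> loses nothing; positive definiteness follows from
  \<open>norm_eq_sqrt_cinner\<close> and the norm axioms.\<close>

class complex_inner = complex_vector + real_normed_vector +
  fixes cinner :: "'a \<Rightarrow> 'a \<Rightarrow> complex"
  assumes cinner_commute: "cinner x y = cnj (cinner y x)"
    and cinner_add_left: "cinner (x + y) z = cinner x z + cinner y z"
    and cinner_scaleC_left: "cinner (a *\<^sub>C x) y = a * cinner x y"
    and norm_eq_sqrt_cinner: "norm x = sqrt (Re (cinner x x))"

class chilbert_space = complex_inner + banach

instantiation complex :: chilbert_space
begin

definition scaleC_complex :: "complex \<Rightarrow> complex \<Rightarrow> complex" where
  "scaleC_complex a x = a * x"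

definition cinner_complex :: "complex \<Rightarrow> complex \<Rightarrow> complex" where
  "cinner_complex x y = x * cnj y"

instance
  by standard
    (simp_all add: scaleC_complex_def cinner_complex_def algebra_simps scaleR_conv_of_real
      cmod_def power2_eq_square)

end

text \<open>Dimension over \<open>\<complex>\<close>, in the algebraic sense.\<close>

definition infinite_cdim :: "'a::complex_vector set \<Rightarrow> bool" where
  "infinite_cdim S \<longleftrightarrow> \<not> (\<exists>B. finite B \<and> S \<subseteq> complex_vector.span B)"

definition separable :: "'a::topological_space set \<Rightarrow> bool" where
  "separable S \<longleftrightarrow> (\<exists>D. countable D \<and> D \<subseteq> S \<and> S \<subseteq> closure D)"

text \<open>Membership in \<open>\<B>(\<H>)\<close>.\<close>

definition bounded_clinear :: "('a::complex_inner \<Rightarrow> 'b::complex_inner) \<Rightarrow> bool" where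
  "bounded_clinear T \<longleftrightarrow>
     (\<forall>x y. T (x + y) = T x + T y) \<and>
     (\<forall>a x. T (a *\<^sub>C x) = a *\<^sub>C T x) \<and>
     (\<exists>K. \<forall>x. norm (T x) \<le> K * norm x)"

text \<open>\<open>THE\<close> is justified for bounded \<open>T\<close> on a Hilbert space by the Riesz representation
  theorem. (The library constant \<open>adjoint\<close> is the adjoint for the real inner product.)\<close>

definition cadjoint :: "('a::chilbert_space \<Rightarrow> 'b::chilbert_space) \<Rightarrow> 'b \<Rightarrow> 'a" where
  "cadjoint T = (THE S. bounded_clinear S \<and> (\<forall>x y. cinner (T x) y = cinner x (S y)))"

definition isometry_op :: "('a::chilbert_space \<Rightarrow> 'a) \<Rightarrow> bool" where
  "isometry_op V \<longleftrightarrow> bounded_clinear V \<and> cadjoint V \<circ> V = id"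

definition left_invertible_op :: "('a::complex_inner \<Rightarrow> 'a) \<Rightarrow> bool" where
  "left_invertible_op T \<longleftrightarrow> bounded_clinear T \<and> (\<exists>S. bounded_clinear S \<and> S \<circ> T = id)"

definition rank_one_op :: "'a::complex_inner \<Rightarrow> 'a \<Rightarrow> 'a \<Rightarrow> 'a" where
  "rank_one_op f g = (\<lambda>h. cinner h g *\<^sub>C f)"

definition c_perturb :: "('a::chilbert_space \<Rightarrow> 'a) \<Rightarrow> 'a \<Rightarrow> 'a \<Rightarrow> real" where
  "c_perturb V f g = ((norm f)\<^sup>2 - (norm (cadjoint V f))\<^sup>2) * (norm g)\<^sup>2
     + (cmod (1 + cinner (cadjoint V f) g))\<^sup>2"

end

(* Let W be the adjoint of V, f0 = f - V W f and a = 1 + <W f, g>. Since f0 is orthogonal to the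
   range of V, c(V; f, g) = |f0|^2 |g|^2 + |a|^2 and (V + f (x) g) h = V (h + <h, g> W f) + <h, g> f0.
   If c = 0, then a = 0 and (as g = 0 would give a = 1) f0 = 0, so W f is a nonzero vector in the
   kernel. If a or f0 is nonzero, <h, g> can be recovered from (V + f (x) g) h by pairing with V g
   or with f0 respectively, so a rank-one correction of W is a left inverse. *)
theory Submission
  imports Defs
begin

section \<open>Complex inner products\<close>

lemma cinner_add_right: "cinner x (y + z) = cinner x y + cinner x z"
  by (metis cinner_add_left cinner_commute complex_cnj_add)

lemma cinner_scaleC_right: "cinner x (a *\<^sub>C y) = cnj a * cinner x y"
  by (metis cinner_commute cinner_scaleC_left complex_cnj_mult)

lemma cinner_minus_left: "cinner (- x) y = - cinner x y"
  using cinner_scaleC_left[of "-1" x y] by simp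

lemma cinner_minus_right: "cinner x (- y) = - cinner x y"
  by (metis cinner_commute cinner_minus_left complex_cnj_minus)

lemma cinner_diff_left: "cinner (x - y) z = cinner x z - cinner y z"
  using cinner_add_left[of x "- y" z] by (simp add: cinner_minus_left)

lemma cinner_diff_right: "cinner x (y - z) = cinner x y - cinner x z"
  using cinner_add_right[of x y "- z"] by (simp add: cinner_minus_right)

lemma cinner_zero_right [simp]: "cinner x 0 = 0"
  using cinner_diff_right[of x 0 0] by simp

lemma cinner_self: "cinner x x = complex_of_real ((norm x)\<^sup>2)"
proof -
  have "Im (cinner x x) = 0"
    using arg_cong[OF cinner_commute[of x x], of Im] by simp
  \<comment> \<open>\<open>sqrt\<close> is odd on the reals, so its nonnegativity rules out a
    negative radicand; only then does squaring undo it.\<close>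
  moreover have "sqrt (Re (cinner x x)) \<ge> 0"
    using norm_ge_zero[of x] by (simp only: norm_eq_sqrt_cinner)
  then have "(norm x)\<^sup>2 = Re (cinner x x)"
    by (simp add: norm_eq_sqrt_cinner)
  ultimately show ?thesis
    by (simp add: complex_eq_iff)
qed

lemma norm_add_square: "(norm (x + y))\<^sup>2 = (norm x)\<^sup>2 + 2 * Re (cinner x y) + (norm y)\<^sup>2"
proof -
  have "Re (cinner (x + y) (x + y)) = Re (cinner x x) + Re (cinner x y) + Re (cinner y x) + Re (cinner y y)"
    by (simp add: cinner_add_left cinner_add_right)
  moreover have "Re (cinner y x) = Re (cinner x y)"
    by (metis cinner_commute complex_cnj(1) complex_surj complex.sel(1))
  ultimately show ?thesis
    by (simp add: cinner_self)
qed

lemma norm_diff_square: "(norm (x - y))\<^sup>2 = (norm x)\<^sup>2 - 2 * Re (cinner x y) + (norm y)\<^sup>2"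
  using norm_add_square[of x "- y"] by (simp add: cinner_minus_right)

text \<open>The norm axioms give homogeneity for real scalars only; the complex case has to come
  from the inner product, by comparing squares.\<close>

lemma norm_scaleC:
  fixes x :: "'a::complex_inner"
  shows "norm (a *\<^sub>C x) = cmod a * norm x"
proof -
  have "complex_of_real ((norm (a *\<^sub>C x))\<^sup>2) = (a * cnj a) * cinner x x"
    unfolding cinner_self[symmetric] by (simp add: cinner_scaleC_left cinner_scaleC_right)
  also have "\<dots> = complex_of_real ((cmod a * norm x)\<^sup>2)"
    by (simp add: cinner_self complex_norm_square power_mult_distrib del: of_real_power)
  finally show ?thesis
    by (simp only: of_real_eq_iff) (simp add: power2_eq_iff_nonneg)
qed

lemma cmod_cinner_le: "cmod (cinner x y) \<le> norm x * norm y"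
proof (cases "y = 0")
  case False
  define n c where "n = (norm y)\<^sup>2" and "c = cinner x y"
  have n: "n > 0" using False by (simp add: n_def)
  \<comment> \<open>The vector is \<open>n\<close> times the component of \<open>x\<close>
    orthogonal to \<open>y\<close>; this scaling avoids a division.\<close>
  have "(norm (complex_of_real n *\<^sub>C x - c *\<^sub>C y))\<^sup>2
      = n\<^sup>2 * (norm x)\<^sup>2 - 2 * Re (complex_of_real n * (cnj c * c)) + (cmod c)\<^sup>2 * n"
    by (simp add: norm_diff_square norm_scaleC cinner_scaleC_left cinner_scaleC_right
        power_mult_distrib n_def c_def norm_power algebra_simps)
  also have "cnj c * c = complex_of_real ((cmod c)\<^sup>2)"
    by (simp add: complex_norm_square mult.commute del: of_real_power)
  finally have "0 \<le> n\<^sup>2 * (norm x)\<^sup>2 - 2 * (n * (cmod c)\<^sup>2) + (cmod c)\<^sup>2 * n"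
    by (metis Re_complex_of_real of_real_mult zero_le_power2)
  then have "n * (cmod c)\<^sup>2 \<le> n * (n * (norm x)\<^sup>2)"
    by (simp add: algebra_simps power2_eq_square)
  then have "(cmod c)\<^sup>2 \<le> (norm x * norm y)\<^sup>2"
    using n by (simp add: n_def power_mult_distrib mult.commute)
  then show ?thesis
    unfolding c_def by (rule power2_le_imp_le) simp
qed simp

text \<open>Nondegeneracy, by testing against \<open>y - z\<close> itself. It yields both the
  linearity and the uniqueness of adjoints.\<close>

lemma cinner_ext_right:
  assumes "\<And>x. cinner x y = cinner x z"
  shows "y = z"
proof -
  have "cinner (y - z) (y - z) = 0"
    using assms by (simp add: cinner_diff_right)
  then show ?thesis
    by (simp add: cinner_self)
qed

section \<open>Bounded operators and adjoints\<close>

lemma bounded_clinearD: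
  assumes "bounded_clinear T"
  shows "T (x + y) = T x + T y" "T (a *\<^sub>C x) = a *\<^sub>C T x" "T (- x) = - T x" "T (x - y) = T x - T y"
proof -
  show add: "T (x + y) = T x + T y" for x y
    using assms by (simp add: bounded_clinear_def)
  show scale: "T (a *\<^sub>C x) = a *\<^sub>C T x" for a x
    using assms by (simp add: bounded_clinear_def)
  show minus: "T (- x) = - T x" for x
    using scale[of "-1" x] by simp
  show "T (x - y) = T x - T y"
    using add[of x "- y"] by (simp add: minus)
qed

lemma bounded_clinear_add:
  assumes "bounded_clinear S" "bounded_clinear T"
  shows "bounded_clinear (\<lambda>x. S x + T x)"
proof -
  obtain K L where "\<And>x. norm (S x) \<le> K * norm x" "\<And>x. norm (T x) \<le> L * norm x"
    using assms unfolding bounded_clinear_def by blast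
  then have "norm (S x + T x) \<le> (K + L) * norm x" for x
    by (metis distrib_right norm_triangle_mono)
  then show ?thesis
    unfolding bounded_clinear_def
    by (auto simp: bounded_clinearD[OF assms(1)] bounded_clinearD[OF assms(2)] scaleC_add_right)
qed

lemma bounded_clinear_rank_one_op: "bounded_clinear (rank_one_op f g)"
proof -
  have "norm (rank_one_op f g x) \<le> (norm g * norm f) * norm x" for x
    using mult_right_mono[OF cmod_cinner_le[of x g], of "norm f"]
    by (simp add: rank_one_op_def norm_scaleC mult_ac)
  then show ?thesis
    unfolding bounded_clinear_def
    by (auto simp: rank_one_op_def cinner_add_left cinner_scaleC_left scaleC_add_left scaleC_scaleC)
qed

text \<open>The representing vector is the minimiser of the strictly convex functional
  \<open>\<parallel>x\<parallel>\<^sup>2 - 2 Re \<phi>(x)\<close>; minimising sequences are Cauchy by the parallelogram law.\<close>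

lemma riesz_representation:
  fixes \<phi> :: "'a::chilbert_space \<Rightarrow> complex"
  assumes \<phi>: "bounded_clinear \<phi>"
  shows "\<exists>z. \<forall>x. \<phi> x = cinner x z"
proof -
  note lin = bounded_clinearD[OF \<phi>]
  have scaleR: "\<phi> (r *\<^sub>R x) = complex_of_real r * \<phi> x" for r x
    using lin(2) by (simp add: scaleR_scaleC scaleC_complex_def)
  obtain K where K: "\<And>x. cmod (\<phi> x) \<le> K * norm x"
    using \<phi> unfolding bounded_clinear_def by blast
  have "bounded_linear \<phi>"
    by (rule bounded_linear_intro[where K = K])
      (use K in \<open>auto simp: lin scaleR scaleR_conv_of_real mult.commute\<close>)
  note \<phi>_tendsto = bounded_linear.tendsto[OF this]
  define F where "F x = (norm x)\<^sup>2 - 2 * Re (\<phi> x)" for x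
  \<comment> \<open>Completing the square: \<open>F x\<close> is at least
    \<open>(norm x - K)\<^sup>2 - K\<^sup>2\<close>.\<close>
  have F_ge: "F x \<ge> - K\<^sup>2" for x
  proof -
    have "Re (\<phi> x) \<le> K * norm x"
      using K[of x] complex_Re_le_cmod[of "\<phi> x"] by linarith
    moreover have "0 \<le> (norm x - K)\<^sup>2" by simp
    ultimately show ?thesis
      by (simp add: F_def power2_diff algebra_simps)
  qed
  have bdd: "bdd_below (range F)"
    using F_ge by (meson bdd_belowI2)
  define m where "m = Inf (range F)"
  have m_le: "m \<le> F x" for x
    unfolding m_def using bdd by (simp add: cInf_lower)
  have "\<exists>x. F x < m + 1 / real (Suc n)" for n
    using cInf_lessD[of "range F" "m + 1 / real (Suc n)"] by (auto simp: m_def)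
  then obtain X where X: "\<And>n. F (X n) < m + 1 / real (Suc n)"
    by metis
  \<comment> \<open>In the parallelogram law for \<open>F\<close> the linear terms cancel, and the
    midpoint still has value at least \<open>m\<close>; hence near-minimisers lie close
    together.\<close>
  have dist: "(norm (a - b))\<^sup>2 \<le> 2 * (F a - m) + 2 * (F b - m)" for a b
  proof -
    have "4 * (norm ((1/2) *\<^sub>R (a + b)))\<^sup>2 = (norm (a + b))\<^sup>2"
      by (simp add: power_divide)
    then have "(norm (a - b))\<^sup>2 + 4 * F ((1/2) *\<^sub>R (a + b)) = 2 * F a + 2 * F b"
      unfolding F_def scaleR lin
      by (simp add: power_divide norm_add_square norm_diff_square add_divide_distrib)
    then show ?thesis
      using m_le[of "(1/2) *\<^sub>R (a + b)"] by simp
  qed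
  have "Cauchy X"
  proof (rule CauchyI)
    fix e :: real assume "e > 0"
    then obtain N where N: "N > 0" "1 / real N < e\<^sup>2 / 4"
      by (metis nat_approx_posE zero_less_Suc zero_less_divide_iff zero_less_numeral zero_less_power)
    have small: "4 * (F (X n) - m) < e\<^sup>2" if "n \<ge> N" for n
    proof -
      have "1 / real (Suc n) \<le> 1 / real N"
        using that N by (intro divide_left_mono) auto
      then show ?thesis using X[of n] N(2) by simp
    qed
    have "norm (X i - X j) < e" if "i \<ge> N" "j \<ge> N" for i j
    proof -
      have "(norm (X i - X j))\<^sup>2 < e\<^sup>2"
        using dist[of "X i" "X j"] small[OF that(1)] small[OF that(2)] by (simp add: algebra_simps)
      then show ?thesis
        using \<open>e > 0\<close> by (simp add: power2_less_imp_less)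
    qed
    then show "\<exists>M. \<forall>i\<ge>M. \<forall>j\<ge>M. norm (X i - X j) < e" by blast
  qed
  then obtain z where z: "X \<longlonglongrightarrow> z"
    using Cauchy_convergent_iff convergent_def by blast
  have "(\<lambda>n. F (X n)) \<longlonglongrightarrow> F z"
    unfolding F_def by (intro tendsto_intros \<phi>_tendsto z)
  moreover have "(\<lambda>n. m + 1 / real (Suc n)) \<longlonglongrightarrow> m + 0"
    by (intro tendsto_intros LIMSEQ_Suc lim_1_over_n)
  ultimately have "F z \<le> m + 0"
    by (rule LIMSEQ_le) (use X less_imp_le in blast)
  then have min: "F z \<le> F x" for x
    using m_le[of x] by simp
  \<comment> \<open>First variation at the minimiser: \<open>2 * d\<close> is the derivative of
    \<open>F\<close> at \<open>z\<close> in direction \<open>h\<close>, so it must vanish.\<close>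
  have Re_eq: "Re (\<phi> h) = Re (cinner h z)" for h
  proof -
    define d n where "d = Re (cinner z h) - Re (\<phi> h)" and "n = (norm h)\<^sup>2"
    have n: "n \<ge> 0" by (simp add: n_def)
    have nonneg: "0 \<le> 2 * t * d + t\<^sup>2 * n" for t
    proof -
      have "F (z + t *\<^sub>R h) = F z + 2 * t * d + t\<^sup>2 * n"
        unfolding F_def lin scaleR norm_add_square
        by (simp add: scaleR_scaleC cinner_scaleC_right norm_scaleC power_mult_distrib d_def n_def
            algebra_simps)
      then show ?thesis using min[of "z + t *\<^sub>R h"] by simp
    qed
    \<comment> \<open>Taking \<open>t = - s\<close> turns the bound into
      \<open>0 \<le> - s\<^sup>2 * (n + 2)\<close>. The denominator \<open>n + 1\<close> stays
      positive even for \<open>h = 0\<close>.\<close>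
    define s where "s = d / (n + 1)"
    have d: "d = s * (n + 1)"
      using n by (simp add: s_def)
    have "s\<^sup>2 * (n + 2) \<le> 0"
      using nonneg[of "- s"] by (simp add: d power2_eq_square algebra_simps)
    then have "d = 0"
      using n by (simp add: d mult_le_0_iff)
    then show ?thesis
      using arg_cong[OF cinner_commute[of z h], of Re] by (simp add: d_def)
  qed
  \<comment> \<open>Real parts at \<open>\<i> *\<^sub>C h\<close> are, up to sign, imaginary parts
    at \<open>h\<close>.\<close>
  have "\<phi> h = cinner h z" for h
    using Re_eq[of h] Re_eq[of "\<i> *\<^sub>C h"]
    by (simp add: complex_eq_iff lin scaleC_complex_def cinner_scaleC_left)
  then show ?thesis by blast
qed

text \<open>Riesz representation of \<open>\<lambda>x. cinner (T x) y\<close> supplies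
  \<open>S y\<close>; linearity in \<open>y\<close> then follows from nondegeneracy.\<close>

lemma adjoint_exists:
  fixes T :: "'a::chilbert_space \<Rightarrow> 'b::chilbert_space"
  assumes T: "bounded_clinear T"
  shows "\<exists>S. bounded_clinear S \<and> (\<forall>x y. cinner (T x) y = cinner x (S y))"
proof -
  note lin = bounded_clinearD[OF T]
  obtain K0 where K0: "\<And>x. norm (T x) \<le> K0 * norm x"
    using T unfolding bounded_clinear_def by blast
  \<comment> \<open>\<open>K0\<close> may be negative if the domain is trivial, while the bound on
    \<open>S\<close> needs a nonnegative constant.\<close>
  define K where "K = \<bar>K0\<bar>"
  have K: "norm (T x) \<le> K * norm x" for x
    unfolding K_def by (rule order_trans[OF K0]) (simp add: mult_right_mono)
  have bound: "cmod (cinner (T x) y) \<le> (norm y * K) * norm x" for x y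
    using cmod_cinner_le[of "T x" y] mult_right_mono[OF K[of x], of "norm y"]
    by (simp add: mult_ac)
  have "bounded_clinear (\<lambda>x. cinner (T x) y)" for y
    unfolding bounded_clinear_def using bound[of _ y]
    by (auto simp: lin cinner_add_left cinner_scaleC_left scaleC_complex_def)
  then have "\<exists>z. \<forall>x. cinner (T x) y = cinner x z" for y
    by (rule riesz_representation)
  then obtain S where S: "\<And>x y. cinner (T x) y = cinner x (S y)"
    by metis
  have "S (x + y) = S x + S y" for x y
    by (rule cinner_ext_right) (simp add: cinner_add_right flip: S)
  moreover have "S (a *\<^sub>C x) = a *\<^sub>C S x" for a x
    by (rule cinner_ext_right) (simp add: cinner_scaleC_right flip: S)
  moreover have "norm (S y) \<le> K * norm y" for y
  proof (cases "S y = 0")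
    case True
    then show ?thesis by (simp add: K_def)
  next
    case False
    \<comment> \<open>Test the adjoint identity at \<open>x = S y\<close>, then cancel one factor
      \<open>norm (S y)\<close>.\<close>
    have "(norm (S y))\<^sup>2 \<le> norm y * K * norm (S y)"
      using bound[of "S y" y] by (simp add: S cinner_self norm_power)
    then show ?thesis
      using False by (simp add: power2_eq_square mult.commute)
  qed
  ultimately have "bounded_clinear S"
    unfolding bounded_clinear_def by blast
  with S show ?thesis by blast
qed

text \<open>Existence and uniqueness together make the definite description in
  \<open>cadjoint\<close> denote the adjoint.\<close>

lemma
  fixes T :: "'a::chilbert_space \<Rightarrow> 'b::chilbert_space"
  assumes "bounded_clinear T"
  shows bounded_clinear_cadjoint: "bounded_clinear (cadjoint T)"
    and cinner_cadjoint: "cinner (T x) y = cinner x (cadjoint T y)"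
proof -
  let ?P = "\<lambda>S. bounded_clinear S \<and> (\<forall>x y. cinner (T x) y = cinner x (S y))"
  obtain S where S: "?P S" using adjoint_exists[OF assms] by blast
  have "S' = S" if "?P S'" for S'
  proof
    show "S' y = S y" for y
      by (rule cinner_ext_right) (metis S that)
  qed
  with S have "?P (cadjoint T)"
    unfolding cadjoint_def by (rule theI)
  then show "bounded_clinear (cadjoint T)" "cinner (T x) y = cinner x (cadjoint T y)"
    by auto
qed

section \<open>Rank-one perturbations of isometries\<close>

theorem theorem1p1:
  fixes V :: "'a::chilbert_space \<Rightarrow> 'a" and f g :: 'a
  assumes "infinite_cdim (UNIV :: 'a set)" and "separable (UNIV :: 'a set)"
    and "isometry_op V"
  shows "left_invertible_op (\<lambda>h. V h + rank_one_op f g h) \<longleftrightarrow> c_perturb V f g \<noteq> 0"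
proof -
  define W where "W = cadjoint V"
  define T where "T = (\<lambda>h. V h + rank_one_op f g h)"
  define f0 where "f0 = f - V (W f)"
  define \<alpha> where "\<alpha> = 1 + cinner (W f) g"
  have V: "bounded_clinear V" and WV: "\<And>x. W (V x) = x"
    using assms(3) by (auto simp: isometry_op_def W_def fun_eq_iff)
  have W: "bounded_clinear W" and VW: "\<And>x y. cinner (V x) y = cinner x (W y)"
    unfolding W_def using bounded_clinear_cadjoint cinner_cadjoint V by blast+
  have WV': "cinner x (V y) = cinner (W x) y" for x y
    by (metis VW cinner_commute)
  have T: "bounded_clinear T"
    unfolding T_def by (intro bounded_clinear_add V bounded_clinear_rank_one_op)
  have W_f0: "W f0 = 0"
    by (simp add: f0_def bounded_clinearD[OF W] WV)
  \<comment> \<open>The difference \<open>f - f0 = V (W f)\<close> is orthogonal to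
    \<open>f0\<close>, because \<open>W f0 = 0\<close>.\<close>
  have f_f0: "cinner f f0 = complex_of_real ((norm f0)\<^sup>2)"
    unfolding cinner_self[symmetric] f0_def by (simp add: cinner_diff_left VW W_f0[unfolded f0_def])
  have norm_V: "norm (V x) = norm x" for x
    by (simp add: norm_eq_sqrt_cinner VW WV)
  have norm_f0: "(norm f0)\<^sup>2 = (norm f)\<^sup>2 - (norm (W f))\<^sup>2"
    by (simp add: f0_def norm_diff_square norm_V WV' cinner_self)
  have c: "c_perturb V f g = (norm f0)\<^sup>2 * (norm g)\<^sup>2 + (cmod \<alpha>)\<^sup>2"
    by (simp add: c_perturb_def norm_f0 \<alpha>_def W_def)
  \<comment> \<open>Since \<open>W (T h) = h + cinner h g *\<^sub>C W f\<close>, the assumption says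
    exactly that the correction \<open>rank_one_op u v\<close> cancels the error of \<open>W\<close>
    as a left inverse.\<close>
  have left_inverse: "left_invertible_op T"
    if "\<And>h. cinner h g *\<^sub>C W f + cinner (T h) v *\<^sub>C u = 0" for u v
  proof -
    have "W (T h) + rank_one_op u v (T h) = h" for h
      using that[of h]
      by (simp add: T_def rank_one_op_def bounded_clinearD[OF W] WV add.assoc)
    then show ?thesis
      unfolding left_invertible_op_def using T
      by (auto simp: fun_eq_iff
          intro!: exI[of _ "\<lambda>y. W y + rank_one_op u v y"] bounded_clinear_add W bounded_clinear_rank_one_op)
  qed
  show ?thesis
    unfolding T_def[symmetric]
  proof
    assume "left_invertible_op T"
    then obtain S where S: "bounded_clinear S" "\<And>x. S (T x) = x"
      by (auto simp: left_invertible_op_def fun_eq_iff)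
    show "c_perturb V f g \<noteq> 0"
    proof
      assume "c_perturb V f g = 0"
      then have "\<alpha> = 0" and "f0 = 0 \<or> g = 0"
        unfolding c by (simp_all add: add_nonneg_eq_0_iff)
      moreover from \<open>\<alpha> = 0\<close> have Wf: "cinner (W f) g = - 1"
        by (simp add: \<alpha>_def add_eq_0_iff)
      ultimately have "f0 = 0" by auto
      \<comment> \<open>With \<open>cinner (W f) g = - 1\<close>, the value \<open>T (W f)\<close>
        is \<open>V (W f) - f = - f0\<close>.\<close>
      then have "T (W f) = 0"
        by (simp add: T_def rank_one_op_def Wf f0_def)
      then have "W f = 0"
        using S(2)[of "W f"] S(2)[of 0] bounded_clinearD(4)[OF T, of 0 0] by simp
      with Wf cinner_minus_left[of 0 g] show False by simp
    qed
  next
    assume nz: "c_perturb V f g \<noteq> 0"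
    show "left_invertible_op T"
    proof (cases "\<alpha> = 0")
      case False
      \<comment> \<open>Moving \<open>V\<close> across turns the left side into
        \<open>cinner (W (T h)) g\<close>; dividing by \<open>\<alpha>\<close> recovers
        \<open>cinner h g\<close>, whence the factor \<open>- 1 / \<alpha>\<close> in the
        witness.\<close>
      have "cinner (T h) (V g) = \<alpha> * cinner h g" for h
        by (simp add: T_def rank_one_op_def WV' bounded_clinearD[OF W] WV \<alpha>_def cinner_add_left
            cinner_scaleC_left algebra_simps)
      then show ?thesis
        using False
        by (intro left_inverse[of "V g" "(- 1 / \<alpha>) *\<^sub>C W f"]) (simp add: scaleC_scaleC)
    next
      case True
      with nz have "f0 \<noteq> 0" unfolding c by auto
      \<comment> \<open>Pairing with \<open>f0\<close> kills \<open>V h\<close> and leaves only the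
        rank-one term.\<close>
      moreover have "cinner (T h) f0 = complex_of_real ((norm f0)\<^sup>2) * cinner h g" for h
        by (simp add: T_def rank_one_op_def cinner_add_left VW W_f0 cinner_scaleC_left f_f0)
      ultimately show ?thesis
        by (intro left_inverse[of f0 "(- 1 / complex_of_real ((norm f0)\<^sup>2)) *\<^sub>C W f"])
          (simp add: scaleC_scaleC)
    qed
  qed
qed

end
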